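(* Let $p$ be an odd prime and $m\ge1$ an integer, and let $\alpha_0^{(1)},\dots,\alpha_0^{(m)}\in\mathbb{Q}$. Run the $p$-adic Jacobi–Perron algorithm on this input: for $n=0,1,2,\dots$ $$a_n^{(i)}=s(\alpha_n^{(i)})\ (i=1,\dots,m),\quad \alpha_{n+1}^{(1)}=\frac{1}{\alpha_n^{(m)}-a_n^{(m)}},\quad \alpha_{n+1}^{(i)}=\frac{\alpha_n^{(i-1)}-a_n^{(i-1)}}{\alpha_n^{(m)}-a_n^{(m)}}\ (i=2,\dots,m),$$ where the algorithm stops at step $n$ if $\alpha_n^{(m)}=a_n^{(m)}$. Then the algorithm terminates after finitely many steps.
   Context: $s:\mathbb{Q}_p\to\mathbb{Q}$ is the Browkin function: writing $\alpha\in\mathbb{Q}_p$ uniquely as $\alpha=\sum_{j=k}^\infty x_jp^j$ with $k\in\mathbb{Z}$, $x_j\in\mathbb{Z}\cap(-\frac p2,\frac p2)$, set $s(\alpha)=\sum_{j=k}^0x_jp^j$. Rational numbers are viewed as elements of $\mathbb{Q}_p$. *)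

theory Defs
  imports Complex_Main "Berlekamp_Zassenhaus.Finite_Field"
begin

section \<open>The p-adic absolute value on the rationals\<close>

definition padic_val :: "nat \<Rightarrow> rat \<Rightarrow> int" where
  "padic_val p q = int (multiplicity (int p) (fst (quotient_of q)))
                 - int (multiplicity (int p) (snd (quotient_of q)))"

definition padic_abs :: "nat \<Rightarrow> rat \<Rightarrow> real" where
  "padic_abs p q = (if q = 0 then 0 else real p powi (- padic_val p q))"

lemma padic_val_Fract:
  assumes p: "prime p" and a: "a \<noteq> 0" and b: "b \<noteq> 0"
  shows "padic_val p (of_int a / of_int b)
       = int (multiplicity (int p) a) - int (multiplicity (int p) b)"
proof -
  define q :: rat where "q = of_int a / of_int b"
  obtain c d where cd: "quotient_of q = (c, d)" by (cases "quotient_of q")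
  have d: "d > 0" using quotient_of_denom_pos[OF cd] .
  have q: "q = of_int c / of_int d" using quotient_of_div[OF cd] .
  have "q \<noteq> 0" using a b by (simp add: q_def)
  then have c: "c \<noteq> 0" using q by auto
  have "(of_int (a * d) :: rat) = of_int (c * b)"
    using q b d by (simp add: q_def field_simps)
  then have eq: "a * d = c * b" by (simp only: of_int_eq_iff)
  have pe: "prime_elem (int p)" using p by simp
  have "multiplicity (int p) a + multiplicity (int p) d
      = multiplicity (int p) c + multiplicity (int p) b"
    using arg_cong[OF eq, of "multiplicity (int p)"] a b c d
    by (simp add: prime_elem_multiplicity_mult_distrib[OF pe])
  then show ?thesis
    by (simp add: padic_val_def cd flip: q_def)
qed

lemma rat_as_quotient:
  obtains a b :: int where "(q::rat) = of_int a / of_int b" "b \<noteq> 0"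
proof -
  obtain c d where cd: "quotient_of q = (c, d)" by (cases "quotient_of q")
  show thesis
    using that[OF quotient_of_div[OF cd]] quotient_of_denom_pos[OF cd] by simp
qed

lemma padic_abs_0 [simp]: "padic_abs p 0 = 0"
  by (simp add: padic_abs_def)

lemma padic_abs_nonneg [simp]: "padic_abs p q \<ge> 0"
  by (simp add: padic_abs_def)

lemma padic_abs_eq_0_iff: "prime p \<Longrightarrow> padic_abs p q = 0 \<longleftrightarrow> q = 0"
  by (auto simp: padic_abs_def dest: prime_gt_0_nat)

lemma padic_abs_mult:
  assumes p: "prime p"
  shows "padic_abs p (x * y) = padic_abs p x * padic_abs p y"
proof (cases "x = 0 \<or> y = 0")
  case False
  obtain a b where x: "x = of_int a / of_int b" and b: "b \<noteq> 0" by (rule rat_as_quotient)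
  obtain c d where y: "y = of_int c / of_int d" and d: "d \<noteq> 0" by (rule rat_as_quotient)
  have ac: "a \<noteq> 0" "c \<noteq> 0" using False x y by auto
  have xy: "x * y = of_int (a * c) / of_int (b * d)" by (simp add: x y)
  have pe: "prime_elem (int p)" using p by simp
  have "padic_val p (x * y) = padic_val p x + padic_val p y"
    unfolding xy unfolding x y using ac b d
    by (simp only: padic_val_Fract[OF p] mult_eq_0_iff simp_thms
        prime_elem_multiplicity_mult_distrib[OF pe] not_False_eq_True)
  moreover have "real p \<noteq> 0" using p prime_gt_0_nat by auto
  ultimately show ?thesis using False
    by (simp add: padic_abs_def power_int_add power_int_diff power_int_minus divide_simps)
qed auto

lemma padic_abs_1 [simp]: "padic_abs p 1 = 1"
  by (simp add: padic_abs_def padic_val_def)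

lemma padic_abs_minus [simp]: "padic_abs p (- x) = padic_abs p x"
proof (cases "x = 0")
  case False
  have "multiplicity (int p) (- z) = multiplicity (int p) z" for z
    by (rule multiplicity_cong) simp
  with False show ?thesis
    by (auto simp: padic_abs_def padic_val_def rat_uminus_code Let_def split: prod.splits)
qed auto

lemma padic_abs_diff_commute: "padic_abs p (x - y) = padic_abs p (y - x)"
  using padic_abs_minus[of p "x - y"] by simp

lemma padic_abs_inverse:
  assumes "prime p"
  shows "padic_abs p (inverse x) = inverse (padic_abs p x)"
proof (cases "x = 0")
  case False
  then have "padic_abs p x * padic_abs p (inverse x) = 1"
    by (simp flip: padic_abs_mult[OF assms])
  then show ?thesis by (metis inverse_unique)
qed auto

lemma padic_abs_ultra:
  assumes p: "prime p"
  shows "padic_abs p (x + y) \<le> max (padic_abs p x) (padic_abs p y)"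
proof (cases "x = 0 \<or> y = 0 \<or> x + y = 0")
  case False
  obtain a b where x: "x = of_int a / of_int b" and b: "b \<noteq> 0" by (rule rat_as_quotient)
  obtain c d where y: "y = of_int c / of_int d" and d: "d \<noteq> 0" by (rule rat_as_quotient)
  define M where "M = (\<lambda>z. int (multiplicity (int p) z))"
  have x': "x = of_int (a * d) / of_int (b * d)" and y': "y = of_int (c * b) / of_int (b * d)"
    using b d by (simp_all add: x y)
  have xy: "x + y = of_int (a * d + c * b) / of_int (b * d)"
    unfolding x' y' by (simp add: add_divide_distrib)
  have nz: "a * d \<noteq> 0" "c * b \<noteq> 0" "a * d + c * b \<noteq> 0" "b * d \<noteq> 0"
  proof -
    show "a * d \<noteq> 0" using False x d by auto
    show "c * b \<noteq> 0" using False y b by auto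
    show "b * d \<noteq> 0" using b d by simp
    show "a * d + c * b \<noteq> 0" using False xy by (metis div_0 of_int_0)
  qed
  have nu: "\<not> is_unit (int p)" using p prime_gt_1_nat by fastforce
  have "min (M (a * d)) (M (c * b)) \<le> M (a * d + c * b)"
  proof -
    let ?k = "min (multiplicity (int p) (a * d)) (multiplicity (int p) (c * b))"
    have "int p ^ ?k dvd a * d" "int p ^ ?k dvd c * b" by (auto intro!: multiplicity_dvd')
    then have "int p ^ ?k dvd a * d + c * b" by (rule dvd_add)
    then have "?k \<le> multiplicity (int p) (a * d + c * b)"
      using nz(3) nu by (intro multiplicity_geI) auto
    then show ?thesis by (simp add: M_def)
  qed
  moreover have "padic_val p x = M (a * d) - M (b * d)"
    "padic_val p y = M (c * b) - M (b * d)"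
    "padic_val p (x + y) = M (a * d + c * b) - M (b * d)"
    unfolding xy unfolding x' y' M_def by (rule padic_val_Fract[OF p nz(1) nz(4)]
      padic_val_Fract[OF p nz(2) nz(4)] padic_val_Fract[OF p nz(3) nz(4)])+
  ultimately have "- padic_val p (x + y) \<le> - padic_val p x \<or>
                   - padic_val p (x + y) \<le> - padic_val p y"
    by linarith
  moreover have "real p \<ge> 1" using prime_gt_1_nat[OF p] by simp
  ultimately show ?thesis using False
    by (auto simp: padic_abs_def le_max_iff_disj intro: power_int_increasing)
qed (auto simp: add_eq_0_iff le_max_iff_disj)

lemma padic_abs_ultra_diff:
  "prime p \<Longrightarrow> padic_abs p (x - y) \<le> max (padic_abs p x) (padic_abs p y)"
  using padic_abs_ultra[of p x "- y"] by simp

lemma padic_abs_triangle: "prime p \<Longrightarrow> padic_abs p (x + y) \<le> padic_abs p x + padic_abs p y"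
  using padic_abs_ultra[of p x y] padic_abs_nonneg[of p x] padic_abs_nonneg[of p y] by linarith

lemma padic_abs_diff_abs:
  assumes "prime p"
  shows "\<bar>padic_abs p x - padic_abs p y\<bar> \<le> padic_abs p (x - y)"
  using padic_abs_triangle[OF assms, of "x - y" y] padic_abs_triangle[OF assms, of "y - x" x]
  by (simp add: padic_abs_diff_commute[of p y x])

section \<open>Cauchy and null sequences\<close>

definition padic_null :: "nat \<Rightarrow> (nat \<Rightarrow> rat) \<Rightarrow> bool" where
  "padic_null p X \<longleftrightarrow> (\<lambda>n. padic_abs p (X n)) \<longlonglongrightarrow> 0"

definition padic_Cauchy :: "nat \<Rightarrow> (nat \<Rightarrow> rat) \<Rightarrow> bool" where
  "padic_Cauchy p X \<longleftrightarrow>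
     (\<forall>e>0. \<exists>N. \<forall>m\<ge>N. \<forall>n\<ge>N. padic_abs p (X m - X n) < e)"

context
  fixes p :: nat
  assumes p: "prime p"
begin

lemma padic_null_squeeze:
  assumes "padic_null p X" "\<And>n. padic_abs p (Y n) \<le> C * padic_abs p (X n)"
  shows "padic_null p Y"
  unfolding padic_null_def
proof (rule tendsto_sandwich[of "\<lambda>_. 0"])
  show "(\<lambda>n. C * padic_abs p (X n)) \<longlonglongrightarrow> 0"
    using tendsto_mult_left[OF assms(1)[unfolded padic_null_def], of C] by simp
qed (use assms in auto)

lemma padic_null_add:
  assumes "padic_null p X" "padic_null p Y"
  shows "padic_null p (\<lambda>n. X n + Y n)"
  unfolding padic_null_def
proof (rule tendsto_sandwich[of "\<lambda>_. 0"])
  show "(\<lambda>n. padic_abs p (X n) + padic_abs p (Y n)) \<longlonglongrightarrow> 0"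
    using tendsto_add[OF assms[unfolded padic_null_def]] by simp
qed (use padic_abs_triangle[OF p] in auto)

lemma padic_null_minus: "padic_null p (\<lambda>n. - X n) \<longleftrightarrow> padic_null p X"
  by (simp add: padic_null_def)

lemma padic_null_0 [simp]: "padic_null p (\<lambda>n. 0)"
  by (simp add: padic_null_def)

lemma padic_null_const: "padic_null p (\<lambda>n. c) \<longleftrightarrow> c = 0"
  by (simp add: padic_null_def padic_abs_eq_0_iff[OF p] tendsto_const_iff)

lemma padic_Cauchy_const [simp]: "padic_Cauchy p (\<lambda>n. c)"
  by (simp add: padic_Cauchy_def)

lemma padic_Cauchy_add:
  assumes "padic_Cauchy p X" "padic_Cauchy p Y"
  shows "padic_Cauchy p (\<lambda>n. X n + Y n)"
  unfolding padic_Cauchy_def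
proof (intro allI impI)
  fix e :: real assume e: "e > 0"
  obtain M where M: "\<And>m n. m \<ge> M \<Longrightarrow> n \<ge> M \<Longrightarrow> padic_abs p (X m - X n) < e"
    using assms(1) e unfolding padic_Cauchy_def by metis
  obtain N where N: "\<And>m n. m \<ge> N \<Longrightarrow> n \<ge> N \<Longrightarrow> padic_abs p (Y m - Y n) < e"
    using assms(2) e unfolding padic_Cauchy_def by metis
  have "padic_abs p (X m + Y m - (X n + Y n)) < e" if "m \<ge> max M N" "n \<ge> max M N" for m n
    using padic_abs_ultra[OF p, of "X m - X n" "Y m - Y n"] M[of m n] N[of m n] that
    by (simp add: algebra_simps)
  then show "\<exists>N. \<forall>m\<ge>N. \<forall>n\<ge>N. padic_abs p (X m + Y m - (X n + Y n)) < e" by blast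
qed

lemma padic_Cauchy_minus:
  assumes "padic_Cauchy p X"
  shows "padic_Cauchy p (\<lambda>n. - X n)"
  using assms unfolding padic_Cauchy_def
  by (metis minus_diff_minus padic_abs_minus)

lemma padic_Cauchy_abs_convergent:
  assumes "padic_Cauchy p X"
  shows "convergent (\<lambda>n. padic_abs p (X n))"
  unfolding Cauchy_convergent_iff[symmetric] Cauchy_def dist_real_def
  using assms padic_abs_diff_abs[OF p] unfolding padic_Cauchy_def
  by (meson order_le_less_trans)

lemma padic_Cauchy_bounded:
  assumes "padic_Cauchy p X"
  obtains B where "B > 0" "\<And>n. padic_abs p (X n) \<le> B"
proof -
  have "Bseq (\<lambda>n. padic_abs p (X n))"
    using padic_Cauchy_abs_convergent[OF assms] by (rule convergent_imp_Bseq)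
  then show thesis using that unfolding Bseq_def by auto
qed

lemma padic_Cauchy_mult:
  assumes "padic_Cauchy p X" "padic_Cauchy p Y"
  shows "padic_Cauchy p (\<lambda>n. X n * Y n)"
  unfolding padic_Cauchy_def
proof (intro allI impI)
  fix e :: real assume e: "e > 0"
  obtain A where A: "A > 0" "\<And>n. padic_abs p (X n) \<le> A"
    using padic_Cauchy_bounded[OF assms(1)] by blast
  obtain B where B: "B > 0" "\<And>n. padic_abs p (Y n) \<le> B"
    using padic_Cauchy_bounded[OF assms(2)] by blast
  obtain M where M: "\<And>m n. m \<ge> M \<Longrightarrow> n \<ge> M \<Longrightarrow> padic_abs p (X m - X n) < e / B"
    using assms(1) e B(1) unfolding padic_Cauchy_def by (metis divide_pos_pos)
  obtain N where N: "\<And>m n. m \<ge> N \<Longrightarrow> n \<ge> N \<Longrightarrow> padic_abs p (Y m - Y n) < e / A"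
    using assms(2) e A(1) unfolding padic_Cauchy_def by (metis divide_pos_pos)
  have "padic_abs p (X m * Y m - X n * Y n) < e" if mn: "m \<ge> max M N" "n \<ge> max M N" for m n
  proof -
    have "padic_abs p (X m * (Y m - Y n)) \<le> A * padic_abs p (Y m - Y n)"
      unfolding padic_abs_mult[OF p] by (intro mult_right_mono A) auto
    also have "\<dots> < A * (e / A)" by (intro mult_strict_left_mono N A) (use mn in auto)
    finally have 1: "padic_abs p (X m * (Y m - Y n)) < e" using A by simp
    have "padic_abs p ((X m - X n) * Y n) \<le> padic_abs p (X m - X n) * B"
      unfolding padic_abs_mult[OF p] by (intro mult_left_mono B) auto
    also have "\<dots> < e / B * B" by (intro mult_strict_right_mono M B) (use mn in auto)
    finally have 2: "padic_abs p ((X m - X n) * Y n) < e" using B by simp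
    show ?thesis
      using padic_abs_ultra[OF p, of "X m * (Y m - Y n)" "(X m - X n) * Y n"] 1 2
      by (simp add: algebra_simps)
  qed
  then show "\<exists>N. \<forall>m\<ge>N. \<forall>n\<ge>N. padic_abs p (X m * Y m - X n * Y n) < e" by blast
qed

lemma padic_null_mult_Cauchy:
  assumes "padic_null p X" "padic_Cauchy p Y"
  shows "padic_null p (\<lambda>n. X n * Y n)"
proof -
  obtain B where B: "B > 0" "\<And>n. padic_abs p (Y n) \<le> B"
    using padic_Cauchy_bounded[OF assms(2)] by blast
  show ?thesis
    by (rule padic_null_squeeze[OF assms(1), of _ B])
       (use mult_right_mono[OF B(2) padic_abs_nonneg] in \<open>simp add: padic_abs_mult[OF p] mult.commute\<close>)
qed

lemma padic_Cauchy_away_from_0: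
  assumes "padic_Cauchy p X" "\<not> padic_null p X"
  obtains b N where "b > 0" "\<And>n. n \<ge> N \<Longrightarrow> padic_abs p (X n) > b"
proof -
  obtain L where L: "(\<lambda>n. padic_abs p (X n)) \<longlonglongrightarrow> L"
    using padic_Cauchy_abs_convergent[OF assms(1)] by (auto simp: convergent_def)
  have "L \<ge> 0" by (rule LIMSEQ_le_const[OF L]) auto
  moreover have "L \<noteq> 0" using assms(2) L by (auto simp: padic_null_def)
  ultimately have "L > 0" by simp
  then have "eventually (\<lambda>n. padic_abs p (X n) > L / 2) sequentially"
    by (intro order_tendstoD(1)[OF L]) auto
  with \<open>L > 0\<close> show thesis using that[of "L / 2"] by (auto simp: eventually_sequentially)
qed

lemma padic_abs_inverse_diff:
  assumes "b > 0" "padic_abs p x > b" "padic_abs p y > b"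
  shows "padic_abs p (inverse x - inverse y) \<le> padic_abs p (x - y) / (b * b)"
proof -
  have nz: "x \<noteq> 0" "y \<noteq> 0" using assms by auto
  have "inverse x - inverse y = (y - x) * (inverse x * inverse y)"
    using nz by (simp add: field_simps)
  then have "padic_abs p (inverse x - inverse y)
           = padic_abs p (x - y) * inverse (padic_abs p x * padic_abs p y)"
    by (simp add: padic_abs_mult[OF p] padic_abs_inverse[OF p] padic_abs_diff_commute[of p y x])
  also have "\<dots> \<le> padic_abs p (x - y) * inverse (b * b)"
    by (intro mult_left_mono le_imp_inverse_le mult_mono mult_pos_pos) (use assms in auto)
  finally show ?thesis by (simp add: divide_inverse)
qed

lemma padic_Cauchy_inverse:
  assumes "padic_Cauchy p X" "\<not> padic_null p X"
  shows "padic_Cauchy p (\<lambda>n. inverse (X n))"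
  unfolding padic_Cauchy_def
proof (intro allI impI)
  fix e :: real assume e: "e > 0"
  obtain b M where b: "b > 0" "\<And>n. n \<ge> M \<Longrightarrow> padic_abs p (X n) > b"
    using padic_Cauchy_away_from_0[OF assms] by blast
  have "e * (b * b) > 0" using e b by simp
  then obtain N where N: "\<And>m n. m \<ge> N \<Longrightarrow> n \<ge> N \<Longrightarrow> padic_abs p (X m - X n) < e * (b * b)"
    using assms(1) unfolding padic_Cauchy_def by metis
  have "padic_abs p (inverse (X m) - inverse (X n)) < e"
    if mn: "m \<ge> max M N" "n \<ge> max M N" for m n
  proof -
    have "padic_abs p (inverse (X m) - inverse (X n)) \<le> padic_abs p (X m - X n) / (b * b)"
      by (intro padic_abs_inverse_diff b) (use mn in auto)
    also have "\<dots> < e * (b * b) / (b * b)"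
      by (intro divide_strict_right_mono N) (use mn b in auto)
    finally show ?thesis using b by simp
  qed
  then show "\<exists>N. \<forall>m\<ge>N. \<forall>n\<ge>N. padic_abs p (inverse (X m) - inverse (X n)) < e" by blast
qed

lemma padic_null_inverse_diff:
  assumes "padic_Cauchy p X" "\<not> padic_null p X" "padic_Cauchy p Y" "\<not> padic_null p Y"
    and XY: "padic_null p (\<lambda>n. X n - Y n)"
  shows "padic_null p (\<lambda>n. inverse (X n) - inverse (Y n))"
proof -
  obtain b M where b: "b > 0" "\<And>n. n \<ge> M \<Longrightarrow> padic_abs p (X n) > b"
    using padic_Cauchy_away_from_0[OF assms(1,2)] by blast
  obtain c N where c: "c > 0" "\<And>n. n \<ge> N \<Longrightarrow> padic_abs p (Y n) > c"
    using padic_Cauchy_away_from_0[OF assms(3,4)] by blast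
  define d where "d = min b c"
  have d: "d > 0" using b c by (simp add: d_def)
  show ?thesis unfolding padic_null_def
  proof (rule tendsto_sandwich[of "\<lambda>_. 0"])
    show "(\<lambda>n. padic_abs p (X n - Y n) / (d * d)) \<longlonglongrightarrow> 0"
      using tendsto_divide[OF XY[unfolded padic_null_def] tendsto_const, of "d * d"] d by simp
    show "eventually (\<lambda>n. padic_abs p (inverse (X n) - inverse (Y n))
            \<le> padic_abs p (X n - Y n) / (d * d)) sequentially"
      using eventually_ge_at_top[of "max M N"]
    proof eventually_elim
      case (elim n)
      have "padic_abs p (X n) > d" "padic_abs p (Y n) > d"
        using b(2)[of n] c(2)[of n] elim by (auto simp: d_def)
      then show ?case by (rule padic_abs_inverse_diff[OF d])
    qed
  qed auto
qed

lemma padic_null_inverse_mult: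
  assumes "padic_Cauchy p X" "\<not> padic_null p X"
  shows "padic_null p (\<lambda>n. inverse (X n) * X n - 1)"
proof -
  obtain b M where b: "b > 0" "\<And>n. n \<ge> M \<Longrightarrow> padic_abs p (X n) > b"
    using padic_Cauchy_away_from_0[OF assms] by blast
  have "padic_abs p (inverse (X n) * X n - 1) = 0" if "n \<ge> M" for n
    using b(1) b(2)[OF that] by (cases "X n = 0") auto
  then have "eventually (\<lambda>n. padic_abs p (inverse (X n) * X n - 1) = 0) sequentially"
    by (auto simp: eventually_sequentially)
  then show ?thesis unfolding padic_null_def by (rule tendsto_eventually)
qed

end

section \<open>The field of p-adic numbers\<close>

text \<open>
  The field of p-adic numbers is the completion of the rationals with respect to the p-adic
  absolute value, i.e. Cauchy sequences modulo null sequences. The prime is p = CARD('p).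
\<close>

lemmas padic_prime_simps =
  padic_null_0[OF prime_card] padic_null_const[OF prime_card]
  padic_Cauchy_const[OF prime_card] padic_Cauchy_add[OF prime_card]
  padic_Cauchy_minus[OF prime_card] padic_Cauchy_mult[OF prime_card]
  padic_Cauchy_inverse[OF prime_card]

typedef (overloaded) 'p padic_seq = "{X. padic_Cauchy CARD('p::prime_card) X}"
  by (rule exI[of _ "\<lambda>_. 0"]) (simp add: padic_prime_simps)

setup_lifting type_definition_padic_seq

instantiation padic_seq :: (prime_card) comm_ring_1
begin

lift_definition zero_padic_seq :: "'a padic_seq" is "\<lambda>_. 0"
  by (simp add: padic_prime_simps)

lift_definition one_padic_seq :: "'a padic_seq" is "\<lambda>_. 1"
  by (simp add: padic_prime_simps)

lift_definition plus_padic_seq :: "'a padic_seq \<Rightarrow> 'a padic_seq \<Rightarrow> 'a padic_seq"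
  is "\<lambda>X Y n. X n + Y n"
  by (simp add: padic_prime_simps)

lift_definition uminus_padic_seq :: "'a padic_seq \<Rightarrow> 'a padic_seq" is "\<lambda>X n. - X n"
  by (simp add: padic_prime_simps)

definition minus_padic_seq :: "'a padic_seq \<Rightarrow> 'a padic_seq \<Rightarrow> 'a padic_seq" where
  "minus_padic_seq X Y = X + - Y"

lift_definition times_padic_seq :: "'a padic_seq \<Rightarrow> 'a padic_seq \<Rightarrow> 'a padic_seq"
  is "\<lambda>X Y n. X n * Y n"
  by (simp add: padic_prime_simps)

instance
proof
  fix X Y Z :: "'a padic_seq"
  show "X + Y + Z = X + (Y + Z)" by transfer (simp add: algebra_simps)
  show "X + Y = Y + X" by transfer (simp add: algebra_simps)
  show "0 + X = X" by transfer simp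
  show "- X + X = 0" by transfer simp
  show "X - Y = X + - Y" by (rule minus_padic_seq_def)
  show "X * Y * Z = X * (Y * Z)" by transfer (simp add: algebra_simps)
  show "X * Y = Y * X" by transfer (simp add: algebra_simps)
  show "1 * X = X" by transfer simp
  show "(X + Y) * Z = X * Z + Y * Z" by transfer (simp add: algebra_simps)
  show "(0 :: 'a padic_seq) \<noteq> 1" by transfer (simp add: fun_eq_iff)
qed

end

lift_definition null_seq :: "'p::prime_card padic_seq \<Rightarrow> bool" is "padic_null CARD('p)" .

lift_definition const_seq :: "rat \<Rightarrow> 'p::prime_card padic_seq" is "\<lambda>q _. q"
  by (simp add: padic_prime_simps)

lift_definition norm_seq :: "'p::prime_card padic_seq \<Rightarrow> real"
  is "\<lambda>X. lim (\<lambda>n. padic_abs CARD('p) (X n))" .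

lift_definition inverse_seq :: "'p::prime_card padic_seq \<Rightarrow> 'p padic_seq"
  is "\<lambda>X. if padic_null CARD('p) X then (\<lambda>_. 0) else (\<lambda>n. inverse (X n))"
  by (simp add: padic_prime_simps)

lemma null_seq_0: "null_seq 0"
  by transfer (simp add: padic_prime_simps)

lemma null_seq_add: "null_seq X \<Longrightarrow> null_seq Y \<Longrightarrow> null_seq (X + Y)"
  by transfer (rule padic_null_add[OF prime_card])

lemma null_seq_minus: "null_seq X \<Longrightarrow> null_seq (- X)"
  by transfer (simp add: padic_null_minus[OF prime_card])

lemma null_seq_mult: "null_seq X \<Longrightarrow> null_seq (X * Y)"
  by transfer (rule padic_null_mult_Cauchy[OF prime_card])

lemma null_seq_cong:
  assumes "null_seq (X - Y)"
  shows "null_seq X \<longleftrightarrow> null_seq Y"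
  using null_seq_add[OF assms, of Y] null_seq_add[OF null_seq_minus[OF assms], of X] by auto

lemma null_seq_inverse_mult: "\<not> null_seq X \<Longrightarrow> null_seq (inverse_seq X * X - 1)"
  unfolding minus_padic_seq_def
  by transfer (use padic_null_inverse_mult[OF prime_card] in simp)

lemma null_seq_inverse_diff:
  assumes "null_seq (X - Y)"
  shows "null_seq (inverse_seq X - inverse_seq Y)"
proof (cases "null_seq X")
  case True
  then have "null_seq Y" using null_seq_cong[OF assms] by simp
  with True have "inverse_seq X = 0" "inverse_seq Y = 0" by (transfer, simp)+
  then show ?thesis by (simp add: null_seq_0)
next
  case False
  then have "\<not> null_seq Y" using null_seq_cong[OF assms] by simp
  with False assms show ?thesis
    unfolding minus_padic_seq_def
    by transfer (use padic_null_inverse_diff[OF prime_card] in simp)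
qed

lemma norm_seq_cong:
  assumes "null_seq (X - Y)"
  shows "norm_seq X = norm_seq Y"
  using assms unfolding minus_padic_seq_def
proof transfer
  fix X Y assume X: "padic_Cauchy CARD('a) X" and null: "padic_null CARD('a) (\<lambda>n. X n + - Y n)"
  obtain L where L: "(\<lambda>n. padic_abs CARD('a) (X n)) \<longlonglongrightarrow> L"
    using padic_Cauchy_abs_convergent[OF prime_card X] by (auto simp: convergent_def)
  have "(\<lambda>n. padic_abs CARD('a) (Y n) - padic_abs CARD('a) (X n)) \<longlonglongrightarrow> 0"
  proof (rule tendsto_0_le[where K = 1])
    show "(\<lambda>n. padic_abs CARD('a) (X n - Y n)) \<longlonglongrightarrow> 0"
      using null by (simp add: padic_null_def)
    show "\<forall>\<^sub>F n in sequentially. norm (padic_abs CARD('a) (Y n) - padic_abs CARD('a) (X n))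
        \<le> norm (padic_abs CARD('a) (X n - Y n)) * 1"
      using padic_abs_diff_abs[OF prime_card[where 'a = 'a]]
      by (subst padic_abs_diff_commute) (auto intro!: always_eventually)
  qed
  from tendsto_add[OF this L] have "(\<lambda>n. padic_abs CARD('a) (Y n)) \<longlonglongrightarrow> L" by simp
  with L show "lim (\<lambda>n. padic_abs CARD('a) (X n)) = lim (\<lambda>n. padic_abs CARD('a) (Y n))"
    by (simp add: limI)
qed

definition padic_rel :: "'p::prime_card padic_seq \<Rightarrow> 'p padic_seq \<Rightarrow> bool" where
  "padic_rel X Y \<longleftrightarrow> null_seq (X - Y)"

lemma equivp_padic_rel: "equivp padic_rel"
proof (intro equivpI reflpI sympI transpI)
  fix X Y Z :: "'a padic_seq"
  show "padic_rel X X" by (simp add: padic_rel_def null_seq_0)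
  show "padic_rel X Y \<Longrightarrow> padic_rel Y X"
    using null_seq_minus[of "X - Y"] by (simp add: padic_rel_def)
  show "padic_rel X Y \<Longrightarrow> padic_rel Y Z \<Longrightarrow> padic_rel X Z"
    using null_seq_add[of "X - Y" "Y - Z"] by (simp add: padic_rel_def)
qed

quotient_type (overloaded) 'p padic = "'p::prime_card padic_seq" / padic_rel
  by (rule equivp_padic_rel)

instantiation padic :: (prime_card) field
begin

lift_definition zero_padic :: "'a padic" is 0 .

lift_definition one_padic :: "'a padic" is 1 .

lift_definition plus_padic :: "'a padic \<Rightarrow> 'a padic \<Rightarrow> 'a padic" is "(+)"
  unfolding padic_rel_def
  by (metis null_seq_add add_diff_add)

lift_definition uminus_padic :: "'a padic \<Rightarrow> 'a padic" is uminus
  unfolding padic_rel_def by (metis null_seq_minus minus_diff_minus)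

definition minus_padic :: "'a padic \<Rightarrow> 'a padic \<Rightarrow> 'a padic" where
  "minus_padic x y = x + - y"

lift_definition times_padic :: "'a padic \<Rightarrow> 'a padic \<Rightarrow> 'a padic" is "(*)"
proof -
  fix X X' Y Y' :: "'a padic_seq" assume r: "padic_rel X X'" "padic_rel Y Y'"
  have "null_seq ((X - X') * Y + (Y - Y') * X')"
    using r by (intro null_seq_add null_seq_mult) (auto simp: padic_rel_def)
  then show "padic_rel (X * Y) (X' * Y')" by (simp add: padic_rel_def algebra_simps)
qed

lift_definition inverse_padic :: "'a padic \<Rightarrow> 'a padic" is inverse_seq
  by (simp add: padic_rel_def null_seq_inverse_diff)

definition divide_padic :: "'a padic \<Rightarrow> 'a padic \<Rightarrow> 'a padic" where
  "divide_padic x y = x * inverse y"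

instance
proof
  fix a b c :: "'a padic"
  note [simp] = padic_rel_def null_seq_0
  show "a + b + c = a + (b + c)" by transfer (simp add: algebra_simps)
  show "a + b = b + a" by transfer (simp add: algebra_simps)
  show "0 + a = a" by transfer simp
  show "- a + a = 0" by transfer simp
  show "a - b = a + - b" by (rule minus_padic_def)
  show "a * b * c = a * (b * c)" by transfer (simp add: algebra_simps)
  show "a * b = b * a" by transfer (simp add: algebra_simps)
  show "1 * a = a" by transfer simp
  show "(a + b) * c = a * c + b * c" by transfer (simp add: algebra_simps)
  have "\<not> null_seq (1 :: 'a padic_seq)" by transfer (simp add: padic_prime_simps)
  then show "(0 :: 'a padic) \<noteq> 1"
    by transfer (use null_seq_minus[of "- 1 :: 'a padic_seq"] in auto)
  show "a \<noteq> 0 \<Longrightarrow> inverse a * a = 1"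
    by transfer (simp add: null_seq_inverse_mult)
  show "a div b = a * inverse b" by (rule divide_padic_def)
  have "inverse_seq 0 = (0 :: 'a padic_seq)" by transfer (simp add: padic_prime_simps)
  then show "inverse (0 :: 'a padic) = 0" by transfer simp
qed

end

lift_definition padic_of_rat :: "rat \<Rightarrow> 'p::prime_card padic" is const_seq .

lemma padic_of_rat_eq_iff: "(padic_of_rat q :: 'p::prime_card padic) = padic_of_rat r \<longleftrightarrow> q = r"
  by transfer (unfold padic_rel_def minus_padic_seq_def, transfer, simp add: padic_prime_simps)

lemma padic_of_rat_0: "padic_of_rat 0 = (0 :: 'p::prime_card padic)"
  by transfer (unfold padic_rel_def minus_padic_seq_def, transfer, simp add: padic_prime_simps)

lemma padic_of_rat_1: "padic_of_rat 1 = (1 :: 'p::prime_card padic)"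
  by transfer (unfold padic_rel_def minus_padic_seq_def, transfer, simp add: padic_prime_simps)

lemma padic_of_rat_add:
  "padic_of_rat (q + r) = (padic_of_rat q + padic_of_rat r :: 'p::prime_card padic)"
  by transfer (unfold padic_rel_def minus_padic_seq_def, transfer, simp add: padic_prime_simps)

lemma of_nat_padic: "(of_nat n :: 'p::prime_card padic) = padic_of_rat (of_nat n)"
  by (induction n) (simp_all add: padic_of_rat_0 padic_of_rat_1 padic_of_rat_add)

instance padic :: (prime_card) field_char_0
  by standard (simp add: inj_on_def of_nat_padic padic_of_rat_eq_iff)

lift_definition padic_norm :: "'p::prime_card padic \<Rightarrow> real" is norm_seq
  by (simp add: padic_rel_def norm_seq_cong)

section \<open>The Browkin function\<close>

text \<open>
  The expansion \<open>\<alpha> = (\<Sum>j\<ge>k. x j * p ^ j)\<close> with balanced digits; the series converges in the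
  p-adic absolute value. Only the digits \<open>x j\<close> with \<open>j \<ge> k\<close> matter.
\<close>

definition balanced_expansion :: "'p::prime_card padic \<Rightarrow> int \<Rightarrow> (int \<Rightarrow> int) \<Rightarrow> bool" where
  "balanced_expansion \<alpha> k x \<longleftrightarrow>
     (\<forall>j\<ge>k. - (real CARD('p) / 2) < of_int (x j) \<and> of_int (x j) < real CARD('p) / 2) \<and>
     (\<lambda>N. padic_norm (\<alpha> - (\<Sum>j = k..int N. of_int (x j) * of_nat CARD('p) powi j)))
       \<longlonglongrightarrow> 0"

text \<open>
  The starting index \<open>k\<close> is not unique (leading zeros may be added), but the truncated sum is.
\<close>

definition browkin_s :: "'p::prime_card padic \<Rightarrow> rat" where
  "browkin_s \<alpha> = (THE r. \<exists>k x. balanced_expansion \<alpha> k x \<and>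
     r = (\<Sum>j = k..0. of_int (x j) * of_nat CARD('p) powi j))"

section \<open>The p-adic Jacobi--Perron algorithm\<close>

text \<open>
  An \<open>m\<close>-tuple is a function on \<open>nat\<close> of which only the values at \<open>1, \<dots>, m\<close> matter.
\<close>

definition jp_stops :: "nat \<Rightarrow> (nat \<Rightarrow> 'p::prime_card padic) \<Rightarrow> bool" where
  "jp_stops m \<alpha> \<longleftrightarrow> \<alpha> m = of_rat (browkin_s (\<alpha> m))"

definition jp_step :: "nat \<Rightarrow> (nat \<Rightarrow> 'p::prime_card padic) \<Rightarrow> nat \<Rightarrow> 'p padic" where
  "jp_step m \<alpha> = (\<lambda>i.
     if i = 1 then 1 / (\<alpha> m - of_rat (browkin_s (\<alpha> m)))
     else (\<alpha> (i - 1) - of_rat (browkin_s (\<alpha> (i - 1)))) / (\<alpha> m - of_rat (browkin_s (\<alpha> m))))"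

text \<open>\<open>jp_seq m \<alpha> n\<close> is the \<open>n\<close>-th tuple, or \<open>None\<close> if the algorithm has stopped before step \<open>n\<close>.\<close>

primrec jp_seq :: "nat \<Rightarrow> (nat \<Rightarrow> 'p::prime_card padic) \<Rightarrow> nat \<Rightarrow> (nat \<Rightarrow> 'p padic) option" where
  "jp_seq m \<alpha> 0 = Some \<alpha>"
| "jp_seq m \<alpha> (Suc n) = (case jp_seq m \<alpha> n of
      None \<Rightarrow> None
    | Some \<beta> \<Rightarrow> if jp_stops m \<beta> then None else Some (jp_step m \<beta>))"

end

theory Submission
  imports Defs
begin

text \<open>
  Write the state homogeneously as \<open>\<alpha> i = v i / w\<close>. One step replaces \<open>w\<close> by \<open>v m - a m * w\<close>,
  \<open>v 1\<close> by \<open>w\<close> and \<open>v i\<close> by \<open>v (i - 1) - a (i - 1) * w\<close>. The partial quotients \<open>a i\<close> lie in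
  \<open>\<int>[1/p]\<close> and have absolute value below \<open>p / 2\<close>. Hence, after clearing denominators at the
  start, all coordinates stay in \<open>\<int>[1/p]\<close> and the largest absolute value of a coordinate grows
  at most by the factor \<open>1 + p / 2 < p\<close> per step. On the other hand \<open>|\<alpha> m - a m|\<^sub>p \<le> 1 / p\<close>,
  so the p-adic absolute value of \<open>w\<close> shrinks at least by the factor \<open>p\<close>. Since a nonzero
  \<open>q \<in> \<int>[1/p]\<close> satisfies \<open>|q| * |q|\<^sub>p \<ge> 1\<close>, this cannot go on forever.
\<close>

section \<open>p-adic absolute values of integers, powers of \<open>p\<close> and finite
  sums\<close>

lemma padic_abs_of_int:
  assumes "prime p" "a \<noteq> 0"
  shows "padic_abs p (of_int a) = real p powi (- int (multiplicity (int p) a))"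
  using padic_val_Fract[OF assms(1,2), of 1] assms(2) by (simp add: padic_abs_def)

lemma padic_abs_of_int_le_1:
  assumes "prime p"
  shows "padic_abs p (of_int a) \<le> 1"
  using assms prime_gt_0_nat[OF assms]
  by (cases "a = 0") (auto simp: padic_abs_of_int power_int_minus field_simps)

lemma padic_abs_prime:
  assumes "prime p"
  shows "padic_abs p (of_nat p) = 1 / real p"
proof -
  have "multiplicity (int p) (int p) = 1"
    using assms prime_gt_0_nat[OF assms] by (intro multiplicity_self) (auto simp: not_prime_unit)
  then show ?thesis
    using padic_abs_of_int[OF assms, of "int p"] prime_gt_0_nat[OF assms]
    by (simp add: power_int_minus inverse_eq_divide)
qed

lemma padic_abs_power:
  "prime p \<Longrightarrow> padic_abs p (x ^ n) = padic_abs p x ^ n"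
  by (induction n) (simp_all add: padic_abs_mult)

lemma padic_abs_prime_power_int:
  assumes "prime p"
  shows "padic_abs p (of_nat p powi j) = real p powi (- j)"
proof (cases j rule: int_cases2)
  case (nonneg n)
  then show ?thesis
    by (simp add: padic_abs_power padic_abs_prime assms power_int_minus power_divide
        inverse_eq_divide)
next
  case (nonpos n)
  then show ?thesis
    by (simp add: padic_abs_power padic_abs_prime padic_abs_inverse assms power_int_minus
        power_divide)
qed

lemma padic_abs_sum_le:
  assumes "prime p" "0 \<le> B" "\<And>i. i \<in> A \<Longrightarrow> padic_abs p (f i) \<le> B"
  shows "padic_abs p (sum f A) \<le> B"
proof (cases "finite A")
  case True
  then show ?thesis using assms(3)
  proof (induction A rule: finite_induct)
    case (insert i A)
    then show ?case using padic_abs_ultra[OF assms(1), of "f i" "sum f A"] by force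
  qed (use assms in auto)
qed (use assms in auto)

section \<open>The ring Z[1/p] inside the rationals\<close>

definition Z_inv :: "nat \<Rightarrow> rat set" where
  "Z_inv p = {q. \<exists>k. q * of_nat p ^ k \<in> \<int>}"

lemma Z_inv_of_int [simp]: "of_int a \<in> Z_inv p"
  unfolding Z_inv_def by (auto intro!: exI[of _ 0])

lemma Z_inv_prime_power_int: "prime p \<Longrightarrow> of_nat p powi j \<in> Z_inv p"
  unfolding Z_inv_def
  by (cases j) (auto simp: power_int_def field_simps dest: prime_gt_0_nat intro!: exI[of _ "nat (- j)"])

lemma Z_inv_add:
  assumes "x \<in> Z_inv p" "y \<in> Z_inv p"
  shows "x + y \<in> Z_inv p"
proof -
  obtain k l where k: "x * of_nat p ^ k \<in> \<int>" and l: "y * of_nat p ^ l \<in> \<int>"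
    using assms by (auto simp: Z_inv_def)
  have "(x + y) * of_nat p ^ (k + l)
      = (x * of_nat p ^ k) * of_nat p ^ l + (y * of_nat p ^ l) * of_nat p ^ k"
    by (simp add: algebra_simps power_add)
  also have "\<dots> \<in> \<int>" by (intro Ints_add Ints_mult[OF k] Ints_mult[OF l] Ints_power Ints_of_nat)
  finally show ?thesis by (auto simp: Z_inv_def)
qed

lemma Z_inv_mult:
  assumes "x \<in> Z_inv p" "y \<in> Z_inv p"
  shows "x * y \<in> Z_inv p"
proof -
  obtain k l where k: "x * of_nat p ^ k \<in> \<int>" and l: "y * of_nat p ^ l \<in> \<int>"
    using assms by (auto simp: Z_inv_def)
  have "x * y * of_nat p ^ (k + l) = (x * of_nat p ^ k) * (y * of_nat p ^ l)"
    by (simp add: algebra_simps power_add)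
  also have "\<dots> \<in> \<int>" using k l by (rule Ints_mult)
  finally show ?thesis by (auto simp: Z_inv_def)
qed

lemma Z_inv_diff: "x \<in> Z_inv p \<Longrightarrow> y \<in> Z_inv p \<Longrightarrow> x - y \<in> Z_inv p"
  using Z_inv_add[of x p "- y"] Z_inv_mult[OF Z_inv_of_int[of "-1"], of y p] by simp

lemma Z_inv_sum: "(\<And>i. i \<in> A \<Longrightarrow> f i \<in> Z_inv p) \<Longrightarrow> sum f A \<in> Z_inv p"
  by (induction A rule: infinite_finite_induct)
    (auto intro: Z_inv_add simp: Z_inv_of_int[of 0, simplified])

text \<open>Multiplying \<open>q\<close> by \<open>p ^ k\<close> changes the two absolute values by
  reciprocal factors, so \<open>q\<close> may be replaced by a nonzero integer \<open>a\<close>. If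
  \<open>e\<close> is the multiplicity of \<open>p\<close> in \<open>a\<close>, then
  \<open>p ^ e\<close> divides \<open>a\<close>, hence |a| is at least \<open>p ^ e\<close>, the
  reciprocal of the p-adic absolute value.\<close>

lemma one_le_abs_mult_padic_abs:
  assumes p: "prime p" and q: "q \<in> Z_inv p" "q \<noteq> 0"
  shows "1 \<le> \<bar>real_of_rat q\<bar> * padic_abs p q"
proof -
  have p0: "p > 0" using p prime_gt_0_nat by blast
  obtain k a where a: "q * of_nat p ^ k = of_int a"
    using q by (auto simp: Z_inv_def elim: Ints_cases)
  have a0: "a \<noteq> 0" using a q p0 by auto
  define e where "e = multiplicity (int p) a"
  have "int p ^ e dvd a" unfolding e_def by (rule multiplicity_dvd)
  then have "int p ^ e \<le> \<bar>a\<bar>" using dvd_imp_le_int[OF a0] by fastforce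
  then have "real_of_int (int p ^ e) \<le> real_of_int \<bar>a\<bar>" by (simp only: of_int_le_iff)
  then have "1 \<le> \<bar>real_of_int a\<bar> * padic_abs p (of_int a)"
    using p0 by (simp add: padic_abs_of_int[OF p a0] e_def power_int_minus field_simps)
  also have "real_of_int a = real_of_rat q * real p ^ k"
    using arg_cong[OF a, of real_of_rat] by (simp add: of_rat_mult of_rat_power)
  also have "padic_abs p (of_int a) = padic_abs p q * (1 / real p) ^ k"
    by (simp add: a[symmetric] padic_abs_mult[OF p] padic_abs_power[OF p] padic_abs_prime[OF p])
  finally show ?thesis using p0 by (simp add: abs_mult field_simps)
qed

section \<open>Extraction of a single balanced digit\<close>

lemma balanced_residue:
  fixes y :: int
  assumes "odd p"
  obtains x where "\<bar>2 * x\<bar> < int p" "int p dvd y - x"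
proof -
  have p: "int p > 0" using assms by (auto intro: Nat.gr0I)
  define z where "z = y mod int p"
  have z: "0 \<le> z" "z < int p" "int p dvd y - z" using p by (auto simp: z_def mod_eq_dvd_iff[symmetric])
  show thesis
  proof (cases "2 * z < int p")
    case True
    then show ?thesis using that[of z] z by simp
  next
    case False
    \<comment> \<open>Oddness of \<open>p\<close> rules out the midpoint, so the shifted residue
      \<open>z - p\<close> lies strictly above -p/2.\<close>
    have "2 * z \<noteq> int p" using assms by (metis dvd_triv_left even_of_nat)
    moreover have "int p dvd y - (z - int p)" using dvd_add[OF z(3) dvd_refl] by (simp add: algebra_simps)
    ultimately show ?thesis using that[of "z - int p"] z False by simp
  qed
qed

text \<open>A rational \<open>u = a / b\<close> that is a p-adic integer has a residue modulo
  \<open>p\<close>: \<open>b\<close> is invertible modulo \<open>p\<close> with inverse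
  \<open>y\<close>, and the digit is the balanced representative of \<open>y * a\<close>.\<close>

lemma balanced_digit_unit:
  assumes p: "prime p" "odd p" and u: "padic_abs p u \<le> 1"
  obtains x :: int where "\<bar>2 * x\<bar> < int p" "padic_abs p (u - of_int x) \<le> 1 / real p"
proof -
  have p1: "p > 1" using p prime_gt_1_nat by blast
  obtain a b where ab: "quotient_of u = (a, b)" by (cases "quotient_of u")
  have b: "b > 0" using quotient_of_denom_pos[OF ab] .
  have cop: "coprime a b" using quotient_of_coprime[OF ab] .
  have uab: "u = of_int a / of_int b" using quotient_of_div[OF ab] .
  have pi: "prime (int p)" using p by simp
  \<comment> \<open>The fraction is in lowest terms, so a factor \<open>p\<close> in
    \<open>b\<close> would make the valuation of \<open>u\<close> negative.\<close>
  have ndvd: "\<not> int p dvd b"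
  proof
    assume dvd: "int p dvd b"
    then have na: "\<not> int p dvd a" using cop p1
      by (metis coprime_common_divisor not_prime_unit pi)
    then have "a \<noteq> 0" by auto
    then have "u \<noteq> 0" using uab b by simp
    have "multiplicity (int p) a = 0" using na by (rule not_dvd_imp_multiplicity_0)
    moreover have "multiplicity (int p) b > 0"
      using dvd b pi by (simp add: prime_multiplicity_gt_zero_iff)
    ultimately have "padic_val p u < 0" by (simp add: padic_val_def ab)
    then have "1 < real p powi (- padic_val p u)" using p1 by (intro one_less_power_int) auto
    with u \<open>u \<noteq> 0\<close> show False by (simp add: padic_abs_def)
  qed
  then have "coprime b (int p)" using pi by (metis coprime_commute prime_imp_coprime)
  then obtain y where y: "[b * y = 1] (mod int p)" using cong_solve_coprime_int by blast
  obtain x where x: "\<bar>2 * x\<bar> < int p" "int p dvd y * a - x"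
    using balanced_residue[OF p(2)] by blast
  have "int p dvd (1 - b * y) * a" using y by (simp add: cong_iff_dvd_diff dvd_diff_commute)
  moreover have "a - b * x = (1 - b * y) * a + b * (y * a - x)" by (simp add: algebra_simps)
  ultimately have "int p dvd a - b * x" using x(2) by (metis dvd_add dvd_mult)
  then obtain c where c: "a - b * x = int p * c" by (elim dvdE)
  have "padic_abs p (of_int b) = 1"
    using b ndvd by (simp add: padic_abs_of_int[OF p(1)] not_dvd_imp_multiplicity_0)
  moreover have "(u - of_int x) * of_int b = of_nat p * of_int c"
    using b arg_cong[OF c, of rat_of_int] by (simp add: uab field_simps)
  ultimately have "padic_abs p (u - of_int x) = 1 / real p * padic_abs p (of_int c)"
    by (metis mult.right_neutral padic_abs_mult[OF p(1)] padic_abs_prime[OF p(1)])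
  also have "\<dots> \<le> 1 / real p * 1" by (intro mult_left_mono padic_abs_of_int_le_1 p) auto
  finally show thesis using that x by simp
qed

text \<open>Scaling by \<open>p powi (- k)\<close> reduces this to the case of a p-adic integer. It
  removes the digit at position \<open>k\<close> from a remainder \<open>r\<close>.\<close>

lemma balanced_digit:
  assumes p: "prime p" "odd p" and r: "padic_abs p r \<le> real p powi (- k)"
  obtains x :: int where "\<bar>2 * x\<bar> < int p"
    "padic_abs p (r - of_int x * of_nat p powi k) \<le> real p powi (- (k + 1))"
proof -
  have p0: "p > 0" using p prime_gt_0_nat by blast
  have "padic_abs p (r * of_nat p powi (- k)) \<le> real p powi (- k) * real p powi k"
    using r by (simp add: padic_abs_mult p padic_abs_prime_power_int mult_right_mono)
  also have "\<dots> = 1" using p0 by (simp add: power_int_minus)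
  finally obtain x :: int where x: "\<bar>2 * x\<bar> < int p"
    "padic_abs p (r * of_nat p powi (- k) - of_int x) \<le> 1 / real p"
    using balanced_digit_unit[OF p] by blast
  have "r - of_int x * of_nat p powi k = (r * of_nat p powi (- k) - of_int x) * of_nat p powi k"
    using p0 by (simp add: power_int_minus field_simps)
  then have "padic_abs p (r - of_int x * of_nat p powi k)
      = padic_abs p (r * of_nat p powi (- k) - of_int x) * real p powi (- k)"
    by (simp add: padic_abs_mult p padic_abs_prime_power_int)
  also have "\<dots> \<le> 1 / real p * real p powi (- k)" using x by (intro mult_right_mono) auto
  also have "\<dots> = real p powi (- (k + 1))"
    using p0 by (simp add: power_int_add power_int_minus inverse_eq_divide del: minus_add_distrib)
  finally show thesis using that x by blast
qed

section \<open>Rational numbers inside the p-adic field\<close>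

lemma padic_of_rat_mult:
  "padic_of_rat (q * r) = (padic_of_rat q * padic_of_rat r :: 'p::prime_card padic)"
  by transfer (unfold padic_rel_def minus_padic_seq_def, transfer, simp add: padic_prime_simps)

lemma of_int_padic: "(of_int a :: 'p::prime_card padic) = padic_of_rat (of_int a)"
proof (cases a rule: int_cases2)
  case (nonpos n)
  have "padic_of_rat (of_int a) + (of_nat n :: 'p padic) = 0"
    by (simp add: of_nat_padic padic_of_rat_add[symmetric] nonpos padic_of_rat_0)
  moreover have "(of_int a :: 'p padic) = - of_nat n" by (simp add: nonpos)
  ultimately show ?thesis by (metis eq_neg_iff_add_eq_0)
qed (simp add: of_nat_padic)

text \<open>The algorithm is stated with the generic \<open>of_rat\<close>, while the norm is
  computable on classes of constant sequences; this identifies the two embeddings.\<close>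

lemma of_rat_padic: "(of_rat q :: 'p::prime_card padic) = padic_of_rat q"
proof -
  obtain a b where q: "q = of_int a / of_int b" and b: "b \<noteq> 0" by (rule rat_as_quotient)
  have "padic_of_rat q * (of_int b :: 'p padic) = of_int a"
    using b by (simp add: of_int_padic padic_of_rat_mult[symmetric] q)
  then show ?thesis using b by (simp add: q of_rat_divide field_simps)
qed

lemma padic_norm_of_rat: "padic_norm (of_rat q :: 'p::prime_card padic) = padic_abs CARD('p) q"
  unfolding of_rat_padic by transfer (transfer, simp)

lemma of_rat_power_int: "(of_rat (q powi j) :: 'a::field_char_0) = of_rat q powi j"
  by (cases j rule: int_cases2) (simp_all add: of_rat_power of_rat_inverse power_int_minus)

section \<open>Balanced expansions of rationals and the Browkin function\<close>

definition digit_sum :: "nat \<Rightarrow> (int \<Rightarrow> int) \<Rightarrow> int \<Rightarrow> int \<Rightarrow> rat" where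
  "digit_sum p x k l = (\<Sum>j = k..l. of_int (x j) * of_nat p powi j)"

text \<open>All remainders of a rational number are rational, so convergence can be checked with
  \<open>padic_abs\<close> alone, without further reference to the completion.\<close>

lemma balanced_expansion_of_rat:
  "balanced_expansion (of_rat r :: 'p::prime_card padic) k x \<longleftrightarrow>
     (\<forall>j\<ge>k. \<bar>2 * x j\<bar> < int CARD('p)) \<and>
     (\<lambda>N. padic_abs CARD('p) (r - digit_sum CARD('p) x k (int N))) \<longlonglongrightarrow> 0"
proof -
  have "of_rat r - (\<Sum>j = k..int N. of_int (x j) * of_nat CARD('p) powi j)
      = (of_rat (r - digit_sum CARD('p) x k (int N)) :: 'p padic)" for N
    by (simp add: digit_sum_def of_rat_diff of_rat_sum of_rat_mult of_rat_power_int)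
  moreover have "- (real CARD('p) / 2) < of_int a \<and> of_int a < real CARD('p) / 2
      \<longleftrightarrow> \<bar>2 * a\<bar> < int CARD('p)" for a
    by linarith
  ultimately show ?thesis
    unfolding balanced_expansion_def by (simp only: padic_norm_of_rat)
qed

lemma digit_sum_in_Z_inv: "prime p \<Longrightarrow> digit_sum p x k l \<in> Z_inv p"
  unfolding digit_sum_def by (intro Z_inv_sum Z_inv_mult Z_inv_prime_power_int Z_inv_of_int)

text \<open>Twice a digit is at most \<open>p - 1\<close> in absolute value, and the sum of (p - 1)
  p^j over j from \<open>k\<close> to 0 telescopes to p - p^k. Downward induction on
  \<open>k\<close> proves this sharper bound.\<close>

lemma digit_sum_abs_less:
  assumes p: "p > 0" and x: "\<forall>j\<ge>k. \<bar>2 * x j\<bar> < int p"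
  shows "2 * \<bar>digit_sum p x k 0\<bar> < of_nat p"
proof (cases "k \<le> 0")
  case True
  then have "2 * \<bar>digit_sum p x k 0\<bar> \<le> of_nat p - of_nat p powi k" using x
  proof (induction k rule: int_le_induct)
    case base
    then have "2 * \<bar>x 0\<bar> \<le> int p - 1" by force
    then have "rat_of_int (2 * \<bar>x 0\<bar>) \<le> rat_of_int (int p - 1)" by (simp only: of_int_le_iff)
    then show ?case by (simp add: digit_sum_def)
  next
    case (step k)
    let ?q = "of_nat p powi (k - 1) :: rat"
    have q: "?q > 0" using p by simp
    have pk: "of_nat p powi k = of_nat p * ?q"
      using p power_int_add[of "rat_of_nat p" 1 "k - 1"] by simp
    have "{k - 1..0} = insert (k - 1) {k..0}" using step by auto
    then have eq: "digit_sum p x (k - 1) 0 = of_int (x (k - 1)) * ?q + digit_sum p x k 0"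
      by (simp add: digit_sum_def)
    have "2 * \<bar>x (k - 1)\<bar> \<le> int p - 1" using step.prems by force
    then have "rat_of_int (2 * \<bar>x (k - 1)\<bar>) \<le> rat_of_int (int p - 1)" by (simp only: of_int_le_iff)
    then have "2 * \<bar>rat_of_int (x (k - 1))\<bar> * ?q \<le> (of_nat p - 1) * ?q"
      using q by (intro mult_right_mono) auto
    moreover have "\<bar>digit_sum p x (k - 1) 0\<bar> \<le> \<bar>of_int (x (k - 1))\<bar> * ?q + \<bar>digit_sum p x k 0\<bar>"
      unfolding eq using q by (metis abs_mult abs_of_pos abs_triangle_ineq)
    moreover have "2 * \<bar>digit_sum p x k 0\<bar> \<le> of_nat p - of_nat p * ?q"
      using step by (simp add: pk)
    ultimately show ?case by (simp add: algebra_simps)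
  qed
  moreover have "rat_of_nat p powi k > 0" using p by simp
  ultimately show ?thesis by linarith
\<comment> \<open>For positive \<open>k\<close> the sum is empty.\<close>
qed (use p in \<open>simp add: digit_sum_def\<close>)

text \<open>Some later remainder is below 1/p by convergence, and the digits at positive positions
  in between contribute at most 1/p each; the ultrametric inequality combines them.\<close>

lemma balanced_expansion_remainder:
  assumes "balanced_expansion (of_rat r :: 'p::prime_card padic) k x"
  shows "padic_abs CARD('p) (r - digit_sum CARD('p) x k 0) \<le> 1 / real CARD('p)"
proof -
  let ?p = "CARD('p)"
  have p: "prime ?p" by (rule prime_card)
  have p1: "?p > 1" using p prime_gt_1_nat by blast
  have "(\<lambda>N. padic_abs ?p (r - digit_sum ?p x k (int N))) \<longlonglongrightarrow> 0"
    using assms by (simp add: balanced_expansion_of_rat)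
  then have "eventually (\<lambda>N. padic_abs ?p (r - digit_sum ?p x k (int N)) < 1 / real ?p) sequentially"
    by (rule order_tendstoD) (use p1 in simp)
  then obtain N where N: "padic_abs ?p (r - digit_sum ?p x k (int N)) < 1 / real ?p"
    by (auto simp: eventually_sequentially)
  \<comment> \<open>The set difference also covers \<open>k > 0\<close>, where nothing is
    subtracted; every position in it is at least 1.\<close>
  have "digit_sum ?p x k (int N) - digit_sum ?p x k 0
      = (\<Sum>j\<in>{k..int N} - {k..0}. of_int (x j) * of_nat ?p powi j)"
    unfolding digit_sum_def by (subst sum_diff) auto
  moreover have "padic_abs ?p (\<Sum>j\<in>{k..int N} - {k..0}. of_int (x j) * of_nat ?p powi j)
      \<le> 1 / real ?p"
  proof (rule padic_abs_sum_le[OF p])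
    fix j assume "j \<in> {k..int N} - {k..0}"
    then have "real ?p powi (- j) \<le> real ?p powi (- 1)"
      using p1 by (intro power_int_increasing) auto
    then have "padic_abs ?p (of_int (x j)) * real ?p powi (- j) \<le> 1 * real ?p powi (- 1)"
      by (intro mult_mono padic_abs_of_int_le_1 p) auto
    then show "padic_abs ?p (of_int (x j) * of_nat ?p powi j) \<le> 1 / real ?p"
      by (simp add: padic_abs_mult[OF p] padic_abs_prime_power_int[OF p] inverse_eq_divide)
  qed simp
  ultimately have tail: "padic_abs ?p (digit_sum ?p x k (int N) - digit_sum ?p x k 0) \<le> 1 / real ?p"
    by simp
  have "r - digit_sum ?p x k 0
      = (r - digit_sum ?p x k (int N)) + (digit_sum ?p x k (int N) - digit_sum ?p x k 0)"
    by simp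
  also have "padic_abs ?p \<dots> \<le> 1 / real ?p"
    using N tail by (intro order_trans[OF padic_abs_ultra[OF p]]) auto
  finally show ?thesis .
qed

text \<open>Digits are removed one at a time, starting at the valuation of \<open>r\<close>; the
  remainder after \<open>n\<close> digits has absolute value at most p^(-(k + n)), so the remainders
  tend to 0.\<close>

lemma digit_expansion_exists:
  assumes p: "prime p" "odd p"
  obtains k x where "\<forall>j\<ge>k. \<bar>2 * x j\<bar> < int p"
    "(\<lambda>N. padic_abs p (r - digit_sum p x k (int N))) \<longlonglongrightarrow> 0"
proof -
  have p1: "p > 1" using p prime_gt_1_nat by blast
  define k where "k = padic_val p r"
  \<comment> \<open>The second conjunct pins the chosen sequence to start at \<open>r\<close>, since
    dependent choice only guarantees \<open>P 0\<close> for its first term.\<close>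
  define P where "P = (\<lambda>n t. padic_abs p t \<le> real p powi (- (k + int n)) \<and> (n = 0 \<longrightarrow> t = r))"
  define Q where "Q = (\<lambda>n (t::rat) t'. \<exists>d. \<bar>2 * d\<bar> < int p \<and> t' = t - of_int d * of_nat p powi (k + int n))"
  have "\<exists>f. \<forall>n. P n (f n) \<and> Q n (f n) (f (Suc n))"
  proof (rule dependent_nat_choice)
    show "\<exists>t. P 0 t" by (auto simp: P_def k_def padic_abs_def intro!: exI[of _ r])
    fix t n assume "P n t"
    then have "padic_abs p t \<le> real p powi (- (k + int n))" by (simp add: P_def)
    then obtain d where d: "\<bar>2 * d\<bar> < int p"
      "padic_abs p (t - of_int d * of_nat p powi (k + int n)) \<le> real p powi (- (k + int n + 1))"
      using balanced_digit[OF p] by blast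
    have Suc_n: "k + int (Suc n) = k + int n + 1" by simp
    show "\<exists>t'. P (Suc n) t' \<and> Q n t t'"
      unfolding P_def Q_def Suc_n using d
      by (intro exI[of _ "t - of_int d * of_nat p powi (k + int n)"]) auto
  qed
  then obtain f where f: "\<And>n. P n (f n)" "\<And>n. Q n (f n) (f (Suc n))" by blast
  obtain d where d: "\<And>n. \<bar>2 * d n\<bar> < int p"
    "\<And>n. f (Suc n) = f n - of_int (d n) * of_nat p powi (k + int n)"
    using f(2) unfolding Q_def by metis
  define x where "x = (\<lambda>j. d (nat (j - k)))"
  \<comment> \<open>The first \<open>n\<close> digits occupy positions \<open>k\<close> to
    \<open>k + n - 1\<close>; the sum is empty for \<open>n = 0\<close>.\<close>
  have r: "r - digit_sum p x k (k + int n - 1) = f n" for n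
  proof (induction n)
    case 0
    show ?case using f(1)[of 0] by (simp add: P_def digit_sum_def)
  next
    case (Suc n)
    have "{k..k + int n} = insert (k + int n) {k..k + int n - 1}" by auto
    then have "digit_sum p x k (k + int n)
        = of_int (d n) * of_nat p powi (k + int n) + digit_sum p x k (k + int n - 1)"
      by (simp add: digit_sum_def x_def)
    then show ?case using Suc by (simp add: d(2))
  qed
  have "(\<lambda>N. padic_abs p (r - digit_sum p x k (int N))) \<longlonglongrightarrow> 0"
  proof (rule tendsto_sandwich[of "\<lambda>_. 0"])
    show "(\<lambda>N. inverse (real p) ^ Suc N) \<longlonglongrightarrow> 0"
      using p1 by (intro LIMSEQ_Suc LIMSEQ_power_zero) (simp add: inverse_less_1_iff)
    show "eventually (\<lambda>N. padic_abs p (r - digit_sum p x k (int N)) \<le> inverse (real p) ^ Suc N)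
        sequentially"
      using eventually_ge_at_top[of "nat k"]
    proof eventually_elim
      case (elim N)
      \<comment> \<open>This counts the positions from \<open>k\<close> to \<open>N\<close>; it is
        positive because \<open>N\<close> is at least \<open>k\<close>.\<close>
      define n where "n = nat (int N + 1 - k)"
      have n: "k + int n = int (Suc N)" using elim by (simp add: n_def)
      then have "r - digit_sum p x k (int N) = f n" using r[of n] by simp
      moreover have "padic_abs p (f n) \<le> real p powi (- int (Suc N))"
        using f(1)[of n] unfolding P_def n by simp
      ultimately show ?case
        by (simp only: power_int_minus power_int_of_nat power_inverse)
    qed
  qed auto
  moreover have "\<forall>j\<ge>k. \<bar>2 * x j\<bar> < int p" using d(1) by (simp add: x_def)
  ultimately show thesis using that by blast
qed

text \<open>
  Two candidates for the value of the Browkin function differ by an element of \<open>\<int>[1/p]\<close> which is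
  smaller than \<open>p\<close> in absolute value and at most \<open>1/p\<close> in p-adic absolute value, hence vanishes.
\<close>

lemma digit_sum_unique:
  assumes "balanced_expansion (of_rat r :: 'p::prime_card padic) k x"
    and "balanced_expansion (of_rat r :: 'p padic) l y"
  shows "digit_sum CARD('p) x k 0 = digit_sum CARD('p) y l 0"
proof (rule ccontr)
  let ?p = "CARD('p)"
  let ?d = "digit_sum ?p x k 0 - digit_sum ?p y l 0"
  assume "\<not> ?thesis"
  then have d: "?d \<noteq> 0" by simp
  have p: "prime ?p" by (rule prime_card)
  have p0: "?p > 0" using p prime_gt_0_nat by blast
  have "1 \<le> \<bar>real_of_rat ?d\<bar> * padic_abs ?p ?d"
    using d by (intro one_le_abs_mult_padic_abs Z_inv_diff digit_sum_in_Z_inv p)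
  also have "padic_abs ?p ?d \<le> 1 / real ?p"
    using padic_abs_ultra_diff[OF p, of "r - digit_sum ?p y l 0" "r - digit_sum ?p x k 0"]
      balanced_expansion_remainder[OF assms(1)] balanced_expansion_remainder[OF assms(2)]
    by simp
  then have "\<bar>real_of_rat ?d\<bar> * padic_abs ?p ?d \<le> \<bar>real_of_rat ?d\<bar> * (1 / real ?p)"
    by (rule mult_left_mono) simp
  also have "\<bar>?d\<bar> < of_nat ?p"
    using digit_sum_abs_less[OF p0, of k x] digit_sum_abs_less[OF p0, of l y] assms
    by (simp add: balanced_expansion_of_rat)
  then have "\<bar>real_of_rat ?d\<bar> < real ?p"
    by (metis abs_of_rat of_rat_less of_rat_of_nat_eq)
  then have "\<bar>real_of_rat ?d\<bar> * (1 / real ?p) < 1" using p0 by (simp add: field_simps)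
  finally show False by simp
qed

text \<open>Existence and uniqueness of the truncated sum give the definite description in
  \<open>browkin_s\<close> its value. These three properties of the partial quotients are all that
  the analysis of the algorithm uses.\<close>

lemma browkin_s_of_rat:
  fixes r :: rat
  assumes "odd CARD('p::prime_card)"
  defines "s \<equiv> browkin_s (of_rat r :: 'p padic)"
  shows "s \<in> Z_inv CARD('p)" "2 * \<bar>s\<bar> < of_nat CARD('p)"
    "padic_abs CARD('p) (r - s) \<le> 1 / real CARD('p)"
proof -
  let ?p = "CARD('p)"
  have p: "prime ?p" by (rule prime_card)
  obtain k x where "\<forall>j\<ge>k. \<bar>2 * x j\<bar> < int ?p"
    "(\<lambda>N. padic_abs ?p (r - digit_sum ?p x k (int N))) \<longlonglongrightarrow> 0"
    using digit_expansion_exists[OF p assms(1)] .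
  then have e: "balanced_expansion (of_rat r :: 'p padic) k x"
    by (simp add: balanced_expansion_of_rat)
  have s: "s = digit_sum ?p x k 0"
    unfolding s_def browkin_s_def digit_sum_def[symmetric]
    by (rule the_equality) (use e digit_sum_unique in blast)+
  show "s \<in> Z_inv ?p" unfolding s using p by (rule digit_sum_in_Z_inv)
  show "2 * \<bar>s\<bar> < of_nat ?p" unfolding s
    by (rule digit_sum_abs_less) (use e balanced_expansion_of_rat in auto)
  show "padic_abs ?p (r - s) \<le> 1 / real ?p" unfolding s using e by (rule balanced_expansion_remainder)
qed

section \<open>Homogeneous coordinates for the states of the algorithm\<close>

definition homogeneous_coords ::
  "nat \<Rightarrow> (nat \<Rightarrow> 'p::prime_card padic) \<Rightarrow> rat \<Rightarrow> (nat \<Rightarrow> rat) \<Rightarrow> real \<Rightarrow> bool" where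
  "homogeneous_coords m \<beta> w v B \<longleftrightarrow> w \<noteq> 0 \<and> w \<in> Z_inv CARD('p) \<and> \<bar>real_of_rat w\<bar> \<le> B \<and>
     (\<forall>i\<in>{1..m}. v i \<in> Z_inv CARD('p) \<and> \<bar>real_of_rat (v i)\<bar> \<le> B \<and> \<beta> i = of_rat (v i / w))"

text \<open>The product \<open>D\<close> of the denominators serves as \<open>w\<close>. All
  coordinates are then integers, and an integer has p-adic absolute value at most 1.\<close>

lemma homogeneous_coords_exist:
  fixes \<alpha> :: "nat \<Rightarrow> rat"
  obtains w v B where "homogeneous_coords m (\<lambda>i. of_rat (\<alpha> i) :: 'p::prime_card padic) w v B"
    "padic_abs CARD('p) w \<le> 1"
proof -
  define D where "D = (\<Prod>i\<in>{1..m}. snd (quotient_of (\<alpha> i)))"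
  have D: "D \<noteq> 0" using quotient_of_denom_pos' by (simp add: D_def less_imp_neq[symmetric])
  have "\<alpha> i * of_int D \<in> \<int>" if "i \<in> {1..m}" for i
  proof -
    obtain a b where ab: "quotient_of (\<alpha> i) = (a, b)" by (cases "quotient_of (\<alpha> i)")
    have "b dvd D" using that ab by (auto simp: D_def intro!: dvd_prod_eqI[of _ i])
    then obtain c where "D = b * c" by (elim dvdE)
    then have "\<alpha> i * of_int D = of_int (a * c)"
      using quotient_of_div[OF ab] quotient_of_denom_pos[OF ab] by simp
    then show ?thesis by (metis Ints_of_int)
  qed
  then have v: "\<alpha> i * of_int D \<in> Z_inv CARD('p)" if "i \<in> {1..m}" for i
    using that by (metis Ints_cases Z_inv_of_int)
  \<comment> \<open>The sum of all absolute values dominates each of them.\<close>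
  define B where "B = \<bar>real_of_int D\<bar> + (\<Sum>i\<in>{1..m}. \<bar>real_of_rat (\<alpha> i * of_int D)\<bar>)"
  have "\<bar>real_of_rat (\<alpha> i * of_int D)\<bar> \<le> B" if "i \<in> {1..m}" for i
  proof -
    have "\<bar>real_of_rat (\<alpha> i * of_int D)\<bar> \<le> (\<Sum>i\<in>{1..m}. \<bar>real_of_rat (\<alpha> i * of_int D)\<bar>)"
      using that by (intro member_le_sum) auto
    then show ?thesis by (simp add: B_def)
  qed
  moreover have "\<bar>real_of_int D\<bar> \<le> B" unfolding B_def by (simp add: sum_nonneg)
  ultimately have "homogeneous_coords m (\<lambda>i. of_rat (\<alpha> i) :: 'p padic) (of_int D) (\<lambda>i. \<alpha> i * of_int D) B"
    using D v by (simp add: homogeneous_coords_def)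
  then show thesis using that padic_abs_of_int_le_1[OF prime_card] by blast
qed

text \<open>Each fractional part of the state is \<open>u i / w\<close>, so \<open>w\<close> cancels
  in the quotients that form the next state and \<open>u m\<close> becomes the new
  denominator.\<close>

lemma homogeneous_coords_step:
  fixes \<beta> :: "nat \<Rightarrow> 'p::prime_card padic"
  assumes odd: "odd CARD('p)" and m: "m \<ge> 1"
    and h: "homogeneous_coords m \<beta> w v B" and run: "\<not> jp_stops m \<beta>"
  obtains w' v' where "homogeneous_coords m (jp_step m \<beta>) w' v' ((1 + real CARD('p) / 2) * B)"
    "padic_abs CARD('p) w' \<le> padic_abs CARD('p) w / real CARD('p)"
proof -
  let ?p = "CARD('p)"
  have p: "prime ?p" by (rule prime_card)
  define a where "a = (\<lambda>i. browkin_s (\<beta> i))"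
  define u where "u = (\<lambda>i. v i - a i * w)"
  define v' where "v' = (\<lambda>i. if i = 1 then w else u (i - 1))"
  have w: "w \<noteq> 0" "w \<in> Z_inv ?p" "\<bar>real_of_rat w\<bar> \<le> B" using h by (auto simp: homogeneous_coords_def)
  have v: "v i \<in> Z_inv ?p" "\<bar>real_of_rat (v i)\<bar> \<le> B" "\<beta> i = of_rat (v i / w)"
    if "i \<in> {1..m}" for i using h that unfolding homogeneous_coords_def by blast+
  have a: "a i \<in> Z_inv ?p" "2 * \<bar>a i\<bar> < of_nat ?p" "padic_abs ?p (v i / w - a i) \<le> 1 / real ?p"
    if "i \<in> {1..m}" for i
    using browkin_s_of_rat[OF odd, of "v i / w"] that by (auto simp: a_def v)
  have \<beta>u: "\<beta> i - of_rat (a i) = of_rat (u i / w)" if "i \<in> {1..m}" for i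
    using w that by (simp add: v u_def of_rat_diff[symmetric] field_simps)
  have uZ: "u i \<in> Z_inv ?p" if "i \<in> {1..m}" for i
    using that unfolding u_def by (intro Z_inv_diff Z_inv_mult v a w)
  have uB: "\<bar>real_of_rat (u i)\<bar> \<le> (1 + real ?p / 2) * B" if i: "i \<in> {1..m}" for i
  proof -
    have "real_of_rat (2 * \<bar>a i\<bar>) < real_of_rat (of_nat ?p)" using a(2)[OF i] by (simp only: of_rat_less)
    then have "\<bar>real_of_rat (a i)\<bar> \<le> real ?p / 2" by (simp add: of_rat_mult)
    then have "\<bar>real_of_rat (a i)\<bar> * \<bar>real_of_rat w\<bar> \<le> real ?p / 2 * B"
      using w by (intro mult_mono) auto
    moreover have "\<bar>real_of_rat (u i)\<bar> \<le> \<bar>real_of_rat (v i)\<bar> + \<bar>real_of_rat (a i)\<bar> * \<bar>real_of_rat w\<bar>"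
      unfolding u_def of_rat_diff of_rat_mult abs_mult[symmetric] by (rule abs_triangle_ineq4)
    ultimately show ?thesis using v(2)[OF i] by (simp add: algebra_simps)
  qed
  have mm: "m \<in> {1..m}" using m by simp
  \<comment> \<open>A zero denominator would mean exactly that the algorithm stops at
    \<open>\<beta>\<close>.\<close>
  have um: "u m \<noteq> 0"
  proof
    assume "u m = 0"
    then have "\<beta> m = of_rat (a m)" using \<beta>u[OF mm] by simp
    with run show False unfolding jp_stops_def a_def by blast
  qed
  \<comment> \<open>The old denominator becomes the first new coordinate, so it must obey the new
    bound; \<open>B\<close> is nonnegative because it bounds an absolute value.\<close>
  have wB: "\<bar>real_of_rat w\<bar> \<le> (1 + real ?p / 2) * B"
  proof -
    have "1 * B \<le> (1 + real ?p / 2) * B"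
      using order_trans[OF abs_ge_zero w(3)] by (intro mult_right_mono) auto
    with w(3) show ?thesis by linarith
  qed
  have v'u: "v' i = (if i = 1 then w else u (i - 1))" "i = 1 \<or> i - 1 \<in> {1..m}" if "i \<in> {1..m}" for i
    using that by (auto simp: v'_def)
  have "jp_step m \<beta> i = of_rat (v' i / u m)" if i: "i \<in> {1..m}" for i
  proof (cases "i = 1")
    case True
    then show ?thesis using w um \<beta>u[OF mm] by (simp add: jp_step_def v'_def a_def of_rat_divide)
  next
    case False
    then show ?thesis using w um \<beta>u[OF mm] \<beta>u[of "i - 1"] v'u[OF i]
      by (simp add: jp_step_def a_def of_rat_divide)
  qed
  moreover have "v' i \<in> Z_inv ?p \<and> \<bar>real_of_rat (v' i)\<bar> \<le> (1 + real ?p / 2) * B" if "i \<in> {1..m}" for i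
    using v'u[OF that] uZ[of "i - 1"] uB[of "i - 1"] wB w(2) by (cases "i = 1") auto
  ultimately have "homogeneous_coords m (jp_step m \<beta>) (u m) v' ((1 + real ?p / 2) * B)"
    using um uZ[OF mm] uB[OF mm] by (simp add: homogeneous_coords_def)
  moreover have "padic_abs ?p (u m) \<le> padic_abs ?p w / real ?p"
  proof -
    have "u m = w * (v m / w - a m)" using w by (simp add: u_def field_simps)
    then have "padic_abs ?p (u m) = padic_abs ?p w * padic_abs ?p (v m / w - a m)"
      by (simp only: padic_abs_mult[OF p])
    also have "\<dots> \<le> padic_abs ?p w * (1 / real ?p)" by (intro mult_left_mono a(3) mm) simp
    finally show ?thesis by simp
  qed
  ultimately show thesis using that by blast
qed

section \<open>Termination by comparing real growth with p-adic decay\<close>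

theorem theorem4p11:
  fixes m :: nat and \<alpha> :: "nat \<Rightarrow> rat"
  assumes "odd CARD('p::prime_card)" and "m \<ge> 1"
  shows "\<exists>n \<beta>. jp_seq m (\<lambda>i. of_rat (\<alpha> i) :: 'p padic) n = Some \<beta> \<and> jp_stops m \<beta>"
proof (rule ccontr)
  assume run: "\<not> ?thesis"
  let ?p = "CARD('p)" and ?\<alpha> = "\<lambda>i. of_rat (\<alpha> i) :: 'p padic"
  have p: "prime ?p" by (rule prime_card)
  have p3: "?p \<ge> 3"
    using prime_ge_2_nat[OF p] assms(1) by (cases "?p = 2") auto
  obtain w0 v0 B where 0: "homogeneous_coords m ?\<alpha> w0 v0 B" "padic_abs ?p w0 \<le> 1"
    by (rule homogeneous_coords_exist)
  define L where "L = 1 + real ?p / 2"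
  \<comment> \<open>If no state stops, the step lemma can be iterated for every
    \<open>n\<close>.\<close>
  have "\<exists>\<beta> w v. jp_seq m ?\<alpha> n = Some \<beta> \<and> homogeneous_coords m \<beta> w v (L ^ n * B) \<and>
      padic_abs ?p w \<le> (1 / real ?p) ^ n" for n
  proof (induction n)
    case 0
    show ?case using \<open>homogeneous_coords m ?\<alpha> w0 v0 B\<close> \<open>padic_abs ?p w0 \<le> 1\<close> by auto
  next
    case (Suc n)
    then obtain \<beta> w v where IH: "jp_seq m ?\<alpha> n = Some \<beta>" "homogeneous_coords m \<beta> w v (L ^ n * B)"
      "padic_abs ?p w \<le> (1 / real ?p) ^ n"
      by blast
    have stop: "\<not> jp_stops m \<beta>" using run IH(1) by blast
    obtain w' v' where "homogeneous_coords m (jp_step m \<beta>) w' v' (L * (L ^ n * B))"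
      "padic_abs ?p w' \<le> padic_abs ?p w / real ?p"
      using homogeneous_coords_step[OF assms IH(2) stop] unfolding L_def by blast
    moreover have "padic_abs ?p w / real ?p \<le> (1 / real ?p) ^ Suc n"
      using divide_right_mono[OF IH(3), of "real ?p"] by simp
    ultimately show ?case using IH(1) stop by (auto simp: mult.assoc intro: order_trans)
  qed
  then have w: "\<exists>w. w \<noteq> 0 \<and> w \<in> Z_inv ?p \<and> \<bar>real_of_rat w\<bar> \<le> L ^ n * B \<and>
      padic_abs ?p w \<le> (1 / real ?p) ^ n" for n
    unfolding homogeneous_coords_def by blast
  have "1 \<le> (L / real ?p) ^ n * B" for n
  proof -
    obtain w where w: "w \<noteq> 0" "w \<in> Z_inv ?p" "\<bar>real_of_rat w\<bar> \<le> L ^ n * B"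
      "padic_abs ?p w \<le> (1 / real ?p) ^ n"
      using w by blast
    have "1 \<le> \<bar>real_of_rat w\<bar> * padic_abs ?p w" using one_le_abs_mult_padic_abs[OF p w(2,1)] .
    also have "\<dots> \<le> (L ^ n * B) * (1 / real ?p) ^ n"
      using w(3,4) order_trans[OF abs_ge_zero w(3)] by (intro mult_mono) auto
    finally show ?thesis by (simp add: power_divide)
  qed
  \<comment> \<open>The ratio \<open>L / p\<close> equals 1/p + 1/2, which is below 1 because
    \<open>p\<close> is at least 3.\<close>
  moreover have "(\<lambda>n. (L / real ?p) ^ n * B) \<longlonglongrightarrow> 0"
    using p3 by (intro tendsto_mult_left_zero LIMSEQ_power_zero) (simp add: L_def field_simps)
  ultimately show False using LIMSEQ_le_const[of _ 0 1] by force
qed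

end
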